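(* For every integer $n\geq 1$, $$d_n(x,y,q)=\sum_{F} w(F),$$ where $F$ ranges over all forests of fully planted increasing 0-1-2-plane trees on $[n]$.
   Context: Let $[n]=\{1,\dots,n\}$ and let $D_n$ be the set of permutations of $[n]$ without fixed points (derangements). For a permutation $\sigma$ of $[n]$, $\mathrm{exc}(\sigma)$ is the number of $i$ with $\sigma(i)>i$, $\mathrm{drop}(\sigma)$ is the number of $i$ with $\sigma(i)<i$, and $\mathrm{cyc}(\sigma)$ is the number of cycles of $\sigma$. Define $$d_n(x,y,q)=\sum_{\sigma\in D_n}x^{\mathrm{exc}(\sigma)}y^{\mathrm{drop}(\sigma)}q^{\mathrm{cyc}(\sigma)}.$$ An increasing 0-1-2-plane tree on a nonempty finite set $V$ of integers is a rooted plane tree whose vertices are labeled bijectively by $V$, in which every vertex has $0$, $1$ or $2$ children, the children of a vertex with two children are linearly ordered (left/right), a sole child carries no left/right distinction, and labels increase along every path going away from the root. A fully planted increasing 0-1-2-plane tree on a finite set $U$ of integers with $|U|\ge 2$ consists of a root labeled $\min U$ having exactly one child, this child being the root of an increasing 0-1-2-plane tree on $U\setminus\{\min U\}$ (so a single root is not allowed). A forest of such trees on $[n]$ is an unordered collection of fully planted increasing 0-1-2-plane trees whose label sets partition $[n]$. The weight $w(F)$ of such a forest $F$ is the product of the following vertex weights: the root of each component has weight $q$; each non-root vertex with exactly one child has weight $x+y$; each leaf (vertex with no children) has weight $xy$; each vertex with two children has weight $1$. *)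

theory Defs
  imports "HOL-Combinatorics.Combinatorics" "HOL-Library.Disjoint_Sets"
begin

section \<open>Derangements\<close>

definition derangements :: "nat \<Rightarrow> (nat \<Rightarrow> nat) set" where
  "derangements n = {\<sigma>. \<sigma> permutes {1..n} \<and> (\<forall>i\<in>{1..n}. \<sigma> i \<noteq> i)}"

definition exc :: "nat \<Rightarrow> (nat \<Rightarrow> nat) \<Rightarrow> nat" where
  "exc n \<sigma> = card {i \<in> {1..n}. \<sigma> i > i}"

definition drops :: "nat \<Rightarrow> (nat \<Rightarrow> nat) \<Rightarrow> nat" where
  "drops n \<sigma> = card {i \<in> {1..n}. \<sigma> i < i}"

definition cyc :: "nat \<Rightarrow> (nat \<Rightarrow> nat) \<Rightarrow> nat" where
  "cyc n \<sigma> = card (orbit \<sigma> ` {1..n})"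

text \<open>The polynomial $d_n$ is represented by its evaluations: an identity between such
  evaluations that holds in every commutative ring holds in particular for the generators of
  the polynomial ring in three variables over the integers.\<close>

definition derangement_poly :: "nat \<Rightarrow> 'r::comm_ring_1 \<Rightarrow> 'r \<Rightarrow> 'r \<Rightarrow> 'r" where
  "derangement_poly n x y q =
     (\<Sum>\<sigma>\<in>derangements n. x ^ exc n \<sigma> * y ^ drops n \<sigma> * q ^ cyc n \<sigma>)"

section \<open>Increasing 0-1-2-plane trees\<close>

text \<open>The two children of a \<open>Binary\<close> vertex are ordered, so exchanging
  them gives a different tree in general; the child of a \<open>Unary\<close> vertex has no side.\<close>

datatype 'a tree012 =
    Leaf 'a
  | Unary 'a "'a tree012"
  | Binary 'a "'a tree012" "'a tree012"

fun root_label :: "'a tree012 \<Rightarrow> 'a" where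
  "root_label (Leaf a) = a"
| "root_label (Unary a t) = a"
| "root_label (Binary a l r) = a"

fun labels :: "'a tree012 \<Rightarrow> 'a list" where
  "labels (Leaf a) = [a]"
| "labels (Unary a t) = a # labels t"
| "labels (Binary a l r) = a # labels l @ labels r"

abbreviation label_set :: "'a tree012 \<Rightarrow> 'a set" where
  "label_set t \<equiv> set (labels t)"

fun increasing :: "'a::linorder tree012 \<Rightarrow> bool" where
  "increasing (Leaf a) \<longleftrightarrow> True"
| "increasing (Unary a t) \<longleftrightarrow> a < root_label t \<and> increasing t"
| "increasing (Binary a l r) \<longleftrightarrow>
     a < root_label l \<and> a < root_label r \<and> increasing l \<and> increasing r"

text \<open>Distinctness of the list of labels makes the labeling by \<open>V\<close> bijective.\<close>

definition increasing_tree_on :: "'a::linorder set \<Rightarrow> 'a tree012 \<Rightarrow> bool" where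
  "increasing_tree_on V t \<longleftrightarrow> distinct (labels t) \<and> label_set t = V \<and> increasing t"

definition fully_planted_on :: "'a::linorder set \<Rightarrow> 'a tree012 \<Rightarrow> bool" where
  "fully_planted_on U T \<longleftrightarrow> finite U \<and> card U \<ge> 2 \<and>
     (\<exists>t. T = Unary (Min U) t \<and> increasing_tree_on (U - {Min U}) t)"

text \<open>A set of trees suffices for an unordered collection, since the label sets of the
  components are nonempty and pairwise disjoint.\<close>

definition planted_forest_on :: "'a::linorder set \<Rightarrow> 'a tree012 set \<Rightarrow> bool" where
  "planted_forest_on S F \<longleftrightarrow>
     (\<forall>T\<in>F. fully_planted_on (label_set T) T) \<and>
     disjoint_family_on label_set F \<and> (\<Union>T\<in>F. label_set T) = S"

section \<open>Weights\<close>

text \<open>Product of the weights of all vertices of a subtree none of whose vertices is the root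
  of a component.\<close>

fun nonroot_weight :: "'r::comm_ring_1 \<Rightarrow> 'r \<Rightarrow> 'a tree012 \<Rightarrow> 'r" where
  "nonroot_weight x y (Leaf a) = x * y"
| "nonroot_weight x y (Unary a t) = (x + y) * nonroot_weight x y t"
| "nonroot_weight x y (Binary a l r) = 1 * nonroot_weight x y l * nonroot_weight x y r"

text \<open>Only the \<open>Unary\<close> case occurs for components of a planted forest.\<close>

fun component_weight :: "'r::comm_ring_1 \<Rightarrow> 'r \<Rightarrow> 'r \<Rightarrow> 'a tree012 \<Rightarrow> 'r" where
  "component_weight x y q (Leaf a) = q"
| "component_weight x y q (Unary a t) = q * nonroot_weight x y t"
| "component_weight x y q (Binary a l r) = q * nonroot_weight x y l * nonroot_weight x y r"

definition forest_weight :: "'r::comm_ring_1 \<Rightarrow> 'r \<Rightarrow> 'r \<Rightarrow> 'a tree012 set \<Rightarrow> 'r" where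
  "forest_weight x y q F = (\<Prod>T\<in>F. component_weight x y q T)"

end

theory Submission
  imports Defs
begin

text \<open>Let \<open>m\<close> be the least label. Cutting the cycle through \<open>m\<close> at \<open>m\<close> turns it into a word \<open>w\<close>
  on a set \<open>U\<close> of larger labels, and excedances and drops become the ascents and descents of
  \<open>m w m\<close>. Splitting \<open>w\<close> at its minimum as \<open>u k v\<close> gives the factor \<open>x y\<close> if \<open>u\<close> and \<open>v\<close> are both
  empty, \<open>x\<close> or \<open>y\<close> if exactly one of them is, and \<open>1\<close> otherwise, times the weights of the nonempty
  parts. This is the recursion for increasing 0-1-2-plane trees on \<open>U\<close>, so the cycle contributes
  the same as the planted trees with root \<open>m\<close> on the same labels; the remaining
  cycles and the remaining components are treated recursively.\<close>

section \<open>Words split at a distinguished letter\<close>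

lemma sum_permutations_of_set_insert:
  fixes g :: "'a list \<Rightarrow> 'b::comm_monoid_add"
  assumes "finite V" "m \<notin> V"
  shows "(\<Sum>w\<in>permutations_of_set (insert m V). g w) =
    (\<Sum>A\<in>Pow V. \<Sum>u\<in>permutations_of_set A. \<Sum>v\<in>permutations_of_set (V - A). g (u @ m # v))"
proof -
  define S where "S = (SIGMA A:Pow V. permutations_of_set A \<times> permutations_of_set (V - A))"
  define f where "f = (\<lambda>(A :: 'a set, u, v). u @ m # v)"
  have m: "m \<notin> set u" "m \<notin> set v" if "(A, u, v) \<in> S" for A u v
    using that assms by (auto simp: S_def permutations_of_set_def)
  have inj: "inj_on f S"
  proof (rule inj_onI)
    fix s t assume st: "s \<in> S" "t \<in> S" "f s = f t"
    obtain A u v A' u' v' where eq: "s = (A, u, v)" "t = (A', u', v')"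
      by (cases s, cases t) auto
    have "u @ m # v = u' @ m # v'"
      using st eq by (simp add: f_def)
    \<comment> \<open>The letter \<open>m\<close> occurs only once in each word, so the cut is
      determined, and with it \<open>A\<close> as the letter set of \<open>u\<close>.\<close>
    then have "u = u'" "v = v'"
      using m st eq by (auto simp: append_Cons_eq_iff)
    then show "s = t"
      using st eq by (auto simp: S_def permutations_of_set_def)
  qed
  have "f ` S = permutations_of_set (insert m V)"
  proof (intro equalityI subsetI)
    fix w assume "w \<in> f ` S"
    then show "w \<in> permutations_of_set (insert m V)"
      using assms by (auto simp: f_def S_def permutations_of_set_def)
  next
    fix w assume w: "w \<in> permutations_of_set (insert m V)"
    then have "m \<in> set w" by (auto simp: permutations_of_set_def)
    then obtain u v where uv: "w = u @ m # v" by (meson split_list)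
    have "(set u, u, v) \<in> S"
      using w assms uv by (auto simp: S_def permutations_of_set_def)
    moreover have "f (set u, u, v) = w" using uv by (simp add: f_def)
    ultimately show "w \<in> f ` S" by (metis image_eqI)
  qed
  then have "(\<Sum>w\<in>permutations_of_set (insert m V). g w) = (\<Sum>s\<in>S. g (f s))"
    using sum.reindex[OF inj, of g] by simp
  also have "\<dots> = (\<Sum>A\<in>Pow V. \<Sum>u\<in>permutations_of_set A. \<Sum>v\<in>permutations_of_set (V - A). g (u @ m # v))"
    using assms
    by (simp add: S_def f_def sum.Sigma sum.cartesian_product case_prod_unfold finite_subset)
  finally show ?thesis .
qed

section \<open>Sums over trees and forests\<close>

definition trees_on :: "'a::linorder set \<Rightarrow> 'a tree012 set" where
  "trees_on V = {t. increasing_tree_on V t}"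

lemma root_label_in_label_set: "root_label t \<in> label_set t"
  by (cases t) auto

lemma root_label_le: "increasing t \<Longrightarrow> a \<in> label_set t \<Longrightarrow> root_label t \<le> a"
  by (induction t) force+

lemma trees_on_empty [simp]: "trees_on {} = {}"
  by (metis (mono_tags, lifting) empty_iff equals0I increasing_tree_on_def mem_Collect_eq
      root_label_in_label_set trees_on_def)

text \<open>The least label can only sit at the root; deleting it leaves nothing, one tree, or an
  ordered pair of trees on complementary label sets. The indices \<open>A = {}\<close> and
  \<open>A = V\<close> add nothing, since \<open>trees_on {}\<close> is empty.\<close>

lemma trees_on_insert:
  assumes "\<And>v. v \<in> V \<Longrightarrow> m < v"
  shows "trees_on (insert m V) =
    (if V = {} then {Leaf m} else {}) \<union> Unary m ` trees_on V \<union>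
    (\<lambda>(A, l, r). Binary m l r) ` (SIGMA A:Pow V. trees_on A \<times> trees_on (V - A))"
    (is "_ = ?L \<union> ?U \<union> ?B")
proof (intro equalityI subsetI)
  fix t assume "t \<in> trees_on (insert m V)"
  then have t: "distinct (labels t)" "label_set t = insert m V" "increasing t"
    by (auto simp: trees_on_def increasing_tree_on_def)
  have "root_label t \<le> m" "root_label t \<in> insert m V"
    using root_label_le[OF t(3), of m] root_label_in_label_set[of t] t(2) by auto
  then have root: "root_label t = m" using assms by force
  have m: "m \<notin> V" using assms by blast
  show "t \<in> ?L \<union> ?U \<union> ?B"
  proof (cases t)
    case (Leaf a)
    then have "V = {}" "t = Leaf m" using t root m by auto
    then show ?thesis by simp
  next
    case (Unary a s)
    then have "t = Unary m s" "increasing_tree_on V s"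
      using t root m by (auto simp: increasing_tree_on_def)
    then show ?thesis by (auto simp: trees_on_def)
  next
    case (Binary a l r)
    then have am: "t = Binary m l r" using root by simp
    have "insert m (label_set l \<union> label_set r) = insert m V"
      "m \<notin> label_set l \<union> label_set r" "label_set l \<inter> label_set r = {}"
      using t am by auto
    then have "label_set l \<union> label_set r = V" using m by (metis insert_ident)
    then have mem: "(label_set l, l, r) \<in> (SIGMA A:Pow V. trees_on A \<times> trees_on (V - A))"
      using t am \<open>label_set l \<inter> label_set r = {}\<close>
      by (auto simp: trees_on_def increasing_tree_on_def)
    show ?thesis by (rule UnI2, rule image_eqI[OF _ mem]) (simp add: am)
  qed
next
  fix t assume "t \<in> ?L \<union> ?U \<union> ?B"
  then consider "V = {}" "t = Leaf m" | s where "t = Unary m s" "s \<in> trees_on V"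
    | A l r where "A \<subseteq> V" "t = Binary m l r" "l \<in> trees_on A" "r \<in> trees_on (V - A)"
  proof (elim UnE)
    assume "t \<in> ?B"
    then obtain s where s: "s \<in> (SIGMA A:Pow V. trees_on A \<times> trees_on (V - A))"
        "t = (case s of (A, l, r) \<Rightarrow> Binary m l r)"
      by blast
    obtain A l r where "s = (A, l, r)" by (cases s)
    then show thesis using s by (intro that(3)[of A l r]) simp_all
  qed (use that(1,2) in \<open>auto split: if_splits\<close>)
  then show "t \<in> trees_on (insert m V)"
  proof cases
    case 1
    then show ?thesis by (simp add: trees_on_def increasing_tree_on_def)
  next
    case 2
    then show ?thesis
      using assms root_label_in_label_set[of s] by (auto simp: trees_on_def increasing_tree_on_def)
  next
    case 3
    then show ?thesis
      using assms root_label_in_label_set[of l] root_label_in_label_set[of r]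
      by (auto simp: trees_on_def increasing_tree_on_def)
  qed
qed

text \<open>After the minimum is removed, the recursions cut the remaining set into \<open>A\<close>
  and \<open>V - A\<close>, so the induction hypothesis has to cover every subset and not only
  \<open>V\<close>.\<close>

lemma finite_linorder_min_subset_induct [consumes 1, case_names empty insert]:
  fixes V :: "'a::linorder set"
  assumes "finite V" "P {}"
    and step: "\<And>m V. finite V \<Longrightarrow> (\<And>v. v \<in> V \<Longrightarrow> m < v) \<Longrightarrow> (\<And>A. A \<subseteq> V \<Longrightarrow> P A) \<Longrightarrow> P (insert m V)"
  shows "P V"
  using \<open>finite V\<close>
proof (induction V rule: finite_psubset_induct)
  case (psubset V)
  show ?case
  proof (cases "V = {}")
    case False
    have "P (insert (Min V) (V - {Min V}))"
    proof (rule step)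
      fix v assume "v \<in> V - {Min V}"
      then show "Min V < v" using psubset.hyps by (metis DiffE Min_le insertI1 order_le_imp_less_or_eq)
    next
      fix A assume "A \<subseteq> V - {Min V}"
      moreover have "Min V \<in> V" using False psubset.hyps by simp
      ultimately show "P A" by (intro psubset.IH) blast
    qed (use psubset.hyps in simp)
    then show ?thesis using False psubset.hyps by (simp add: insert_absorb)
  qed (use \<open>P {}\<close> in simp)
qed

lemma finite_trees_on: "finite V \<Longrightarrow> finite (trees_on V)"
proof (induction V rule: finite_linorder_min_subset_induct)
  case (insert m V)
  have "finite (SIGMA A:Pow V. trees_on A \<times> trees_on (V - A))"
    using insert.hyps insert.IH by (intro finite_SigmaI finite_cartesian_product) auto
  then show ?case using insert by (simp add: trees_on_insert)
qed simp

definition tree_sum :: "'r::comm_ring_1 \<Rightarrow> 'r \<Rightarrow> 'a::linorder set \<Rightarrow> 'r" where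
  "tree_sum x y V = (\<Sum>t\<in>trees_on V. nonroot_weight x y t)"

lemma tree_sum_empty [simp]: "tree_sum x y {} = 0"
  by (simp add: tree_sum_def)

lemma tree_sum_insert:
  assumes "finite V" "\<And>v. v \<in> V \<Longrightarrow> m < v"
  shows "tree_sum x y (insert m V) = (if V = {} then x * y else 0) + (x + y) * tree_sum x y V +
    (\<Sum>A\<in>Pow V. tree_sum x y A * tree_sum x y (V - A))"
proof -
  let ?S = "SIGMA A:Pow V. trees_on A \<times> trees_on (V - A)"
  let ?L = "if V = {} then {Leaf m} else {}" and ?U = "Unary m ` trees_on V"
  let ?B = "(\<lambda>(A, l, r). Binary m l r) ` ?S"
  note fin = finite_trees_on[OF finite_subset[OF _ assms(1)]]
  have "finite ?B" "finite ?U" "finite ?L"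
    using assms(1) by (auto intro!: fin finite_imageI finite_SigmaI)
  moreover have "?L \<inter> ?U = {}" "(?L \<union> ?U) \<inter> ?B = {}" by auto
  ultimately have "tree_sum x y (insert m V) =
    sum (nonroot_weight x y) ?L + sum (nonroot_weight x y) ?U + sum (nonroot_weight x y) ?B"
    by (simp only: tree_sum_def trees_on_insert[OF assms(2)] sum.union_disjoint finite_Un)
  moreover have "sum (nonroot_weight x y) ?U = (x + y) * tree_sum x y V"
    by (subst sum.reindex) (auto simp: inj_on_def tree_sum_def sum_distrib_left)
  moreover have "sum (nonroot_weight x y) ?B = (\<Sum>A\<in>Pow V. tree_sum x y A * tree_sum x y (V - A))"
  proof -
    \<comment> \<open>The index \<open>A\<close> is recovered from the tree as the label set of
      \<open>l\<close>.\<close>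
    have "inj_on (\<lambda>(A, l, r). Binary m l r) ?S"
      by (auto simp: inj_on_def trees_on_def increasing_tree_on_def)
    then have "sum (nonroot_weight x y) ?B =
        (\<Sum>(A, l, r)\<in>?S. nonroot_weight x y l * nonroot_weight x y r)"
      by (subst sum.reindex) (auto simp: case_prod_unfold)
    also have "\<dots> = (\<Sum>A\<in>Pow V. \<Sum>(l, r)\<in>trees_on A \<times> trees_on (V - A).
        nonroot_weight x y l * nonroot_weight x y r)"
      using assms(1) by (subst sum.Sigma) (auto intro: fin)
    finally show ?thesis
      by (simp add: tree_sum_def sum_product sum.cartesian_product)
  qed
  ultimately show ?thesis by simp
qed

section \<open>Forests of fully planted trees\<close>

lemma fully_planted_on_iff:
  "fully_planted_on (label_set T) T \<longleftrightarrow>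
    (\<exists>m t. T = Unary m t \<and> t \<in> trees_on (label_set t) \<and> (\<forall>v\<in>label_set t. m < v))"
proof
  assume "fully_planted_on (label_set T) T"
  then obtain t where t: "T = Unary (Min (label_set T)) t"
      "increasing_tree_on (label_set T - {Min (label_set T)}) t"
    by (auto simp: fully_planted_on_def)
  let ?m = "Min (label_set T)"
  have "\<forall>v\<in>label_set t. ?m < v"
  proof
    fix v assume "v \<in> label_set t"
    then have "v \<in> label_set T" "v \<noteq> ?m" using t(2) by (auto simp: increasing_tree_on_def)
    then show "?m < v" by (metis List.finite_set Min_le le_neq_trans)
  qed
  then show "\<exists>m t. T = Unary m t \<and> t \<in> trees_on (label_set t) \<and> (\<forall>v\<in>label_set t. m < v)"
    using t by (auto simp: trees_on_def increasing_tree_on_def)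
next
  assume "\<exists>m t. T = Unary m t \<and> t \<in> trees_on (label_set t) \<and> (\<forall>v\<in>label_set t. m < v)"
  then obtain m t where t: "T = Unary m t" "t \<in> trees_on (label_set t)" "\<forall>v\<in>label_set t. m < v"
    by blast
  have m: "Min (label_set T) = m" using t by (intro Min_eqI) auto
  have nm: "m \<notin> label_set t" using t by auto
  \<comment> \<open>The subtree has at least its own root, which together with \<open>m\<close>
    gives the two labels required.\<close>
  have "card (label_set t) > 0"
    using root_label_in_label_set[of t] by (intro card_gt_0_iff[THEN iffD2]) auto
  then have "card (label_set T) \<ge> 2" using t nm by (simp add: Suc_le_eq)
  moreover have "label_set T - {m} = label_set t" using t nm by simp
  ultimately show "fully_planted_on (label_set T) T"
    unfolding fully_planted_on_def m using t by (simp add: trees_on_def)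
qed

definition forests_on :: "'a::linorder set \<Rightarrow> 'a tree012 set set" where
  "forests_on S = {F. planted_forest_on S F}"

lemma forests_on_empty: "forests_on {} = {{}}"
proof -
  have "F = {}" if "planted_forest_on {} F" for F :: "'a tree012 set"
    using that root_label_in_label_set unfolding planted_forest_on_def by blast
  then show ?thesis
    by (auto simp: forests_on_def planted_forest_on_def disjoint_family_on_def)
qed

text \<open>The component containing the least label \<open>m\<close> must have \<open>m\<close> as
  its root; the other components form an arbitrary forest on the labels that it leaves over.\<close>

lemma forests_on_insert:
  assumes "\<And>v. v \<in> S \<Longrightarrow> m < v"
  shows "forests_on (insert m S) =
    (\<lambda>(U, t, F). insert (Unary m t) F) ` (SIGMA U:Pow S. trees_on U \<times> forests_on (S - U))"
    (is "_ = ?h ` ?S")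
proof (intro equalityI subsetI)
  have m: "m \<notin> S" using assms by blast
  fix F assume "F \<in> forests_on (insert m S)"
  then have F: "\<And>T. T \<in> F \<Longrightarrow> fully_planted_on (label_set T) T" "disjoint_family_on label_set F"
      "(\<Union>T\<in>F. label_set T) = insert m S"
    by (auto simp: forests_on_def planted_forest_on_def)
  from F(3) obtain T where T: "T \<in> F" "m \<in> label_set T" by blast
  then obtain a t where t: "T = Unary a t" "t \<in> trees_on (label_set t)" "\<forall>v\<in>label_set t. a < v"
    using F(1) fully_planted_on_iff by metis
  have sub: "label_set T \<subseteq> insert m S" using F(3) T(1) by blast
  \<comment> \<open>Otherwise \<open>a\<close> would lie in \<open>S\<close> and exceed
    \<open>m\<close>, while \<open>m\<close>, then a label of \<open>t\<close>, would exceed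
    \<open>a\<close>.\<close>
  then have "a = m" using T(2) t assms by fastforce
  have U: "label_set t \<subseteq> S"
    using sub t \<open>a = m\<close> by fastforce
  have "(\<Union>T\<in>F - {T}. label_set T) = S - label_set t"
  proof -
    have "label_set T' \<inter> label_set T = {}" if "T' \<in> F - {T}" for T'
      using F(2) T(1) that by (auto simp: disjoint_family_on_def)
    then have "(\<Union>T\<in>F - {T}. label_set T) = (\<Union>T\<in>F. label_set T) - label_set T"
      using T(1) by blast
    also have "\<dots> = S - label_set t" using F(3) m t \<open>a = m\<close> by auto
    finally show ?thesis .
  qed
  moreover have "disjoint_family_on label_set (F - {T})"
    using F(2) by (auto simp: disjoint_family_on_def)
  ultimately have "F - {T} \<in> forests_on (S - label_set t)"
    using F(1) by (auto simp: forests_on_def planted_forest_on_def)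
  then have mem: "(label_set t, t, F - {T}) \<in> ?S" using U t by auto
  have "F = insert T (F - {T})" using T by blast
  then show "F \<in> ?h ` ?S" using t \<open>a = m\<close> by (intro image_eqI[OF _ mem]) simp
next
  fix F assume "F \<in> ?h ` ?S"
  then obtain s where s: "s \<in> ?S" "F = ?h s" by blast
  obtain U t F' where "s = (U, t, F')" by (cases s)
  then have F: "F = insert (Unary m t) F'" "U \<subseteq> S" "t \<in> trees_on U" "F' \<in> forests_on (S - U)"
    using s by simp_all
  have U: "label_set t = U" using F by (auto simp: trees_on_def increasing_tree_on_def)
  have "fully_planted_on (label_set (Unary m t)) (Unary m t)"
    unfolding fully_planted_on_iff using F U assms by blast
  moreover have "label_set (Unary m t) \<inter> label_set T = {}" if "T \<in> F'" for T
  proof -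
    have "label_set T \<subseteq> S - U" using F(4) that by (auto simp: forests_on_def planted_forest_on_def)
    then show ?thesis using U assms by fastforce
  qed
  ultimately show "F \<in> forests_on (insert m S)"
    using F U by (auto simp: forests_on_def planted_forest_on_def disjoint_family_on_def)
qed

lemma finite_forests_on: "finite S \<Longrightarrow> finite (forests_on S)"
proof (induction S rule: finite_linorder_min_subset_induct)
  case (insert m S)
  have "finite (SIGMA U:Pow S. trees_on U \<times> forests_on (S - U))"
    using insert.hyps insert.IH
    by (intro finite_SigmaI finite_cartesian_product finite_trees_on) (auto intro: finite_subset)
  then show ?case using insert by (simp add: forests_on_insert)
qed (simp add: forests_on_empty)

definition forest_sum :: "'r::comm_ring_1 \<Rightarrow> 'r \<Rightarrow> 'r \<Rightarrow> 'a::linorder set \<Rightarrow> 'r" where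
  "forest_sum x y q S = (\<Sum>F\<in>forests_on S. forest_weight x y q F)"

lemma forest_sum_empty [simp]: "forest_sum x y q {} = 1"
  by (simp add: forest_sum_def forests_on_empty forest_weight_def)

text \<open>The label sets of the components are nonempty and disjoint, so \<open>label_set\<close>
  embeds the forest into \<open>Pow S\<close>. Finiteness is what lets the weight of an inserted
  component split off from the product.\<close>

lemma finite_planted_forest:
  assumes "F \<in> forests_on S" "finite S"
  shows "finite F"
proof -
  have "inj_on label_set F"
    using assms root_label_in_label_set
    by (fastforce simp: inj_on_def forests_on_def planted_forest_on_def disjoint_family_on_def)
  moreover have "label_set ` F \<subseteq> Pow S"
    using assms by (auto simp: forests_on_def planted_forest_on_def)
  ultimately show ?thesis
    using assms(2) by (meson finite_Pow_iff finite_imageD finite_subset)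
qed

lemma forest_sum_insert:
  fixes S :: "'a::linorder set"
  assumes "finite S" "\<And>v. v \<in> S \<Longrightarrow> m < v"
  shows "forest_sum x y q (insert m S) =
    (\<Sum>U\<in>Pow S. q * tree_sum x y U * forest_sum x y q (S - U))"
proof -
  let ?S = "SIGMA U:Pow S. trees_on U \<times> forests_on (S - U)"
  let ?h = "\<lambda>(U :: 'a set, t, F). insert (Unary m t) F"
  \<comment> \<open>No tree of \<open>F\<close> carries the label \<open>m\<close>. Hence the
    insertion adds a genuinely new factor, and \<open>t\<close> and \<open>F\<close> can be read off
    the resulting forest.\<close>
  have new: "Unary m t \<notin> F" if "F \<in> forests_on (S - U)" for t U F
  proof
    assume "Unary m t \<in> F"
    then have "m \<in> S"
      using that by (force simp: forests_on_def planted_forest_on_def)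
    then show False using assms(2) by blast
  qed
  have inj: "inj_on ?h ?S"
  proof (rule inj_onI)
    fix s s' assume s: "s \<in> ?S" "s' \<in> ?S" "?h s = ?h s'"
    obtain U t F U' t' F' where eq: "s = (U, t, F)" "s' = (U', t', F')"
      by (cases s, cases s') auto
    have *: "t \<in> trees_on U" "F \<in> forests_on (S - U)" "t' \<in> trees_on U'"
        "F' \<in> forests_on (S - U')" "insert (Unary m t) F = insert (Unary m t') F'"
      using s eq by auto
    have "Unary m t = Unary m t'" using * new by (metis insertE insertI1)
    moreover from this have "F = F'" using * new by (metis insert_ident)
    ultimately show "s = s'"
      using * eq by (auto simp: trees_on_def increasing_tree_on_def)
  qed
  have "forest_sum x y q (insert m S) = (\<Sum>s\<in>?S. forest_weight x y q (?h s))"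
    using sum.reindex[OF inj, of "forest_weight x y q"]
    by (simp add: forest_sum_def forests_on_insert[OF assms(2)])
  also have "\<dots> = (\<Sum>(U, t, F)\<in>?S. q * nonroot_weight x y t * forest_weight x y q F)"
  proof (rule sum.cong[OF refl], clarify)
    fix U t F assume "U \<subseteq> S" "t \<in> trees_on U" "F \<in> forests_on (S - U)"
    then show "forest_weight x y q (insert (Unary m t) F) =
        q * nonroot_weight x y t * forest_weight x y q F"
      using new[of F U t] finite_planted_forest[of F "S - U"] assms(1)
      by (simp add: forest_weight_def)
  qed
  also have "\<dots> = (\<Sum>U\<in>Pow S. \<Sum>(t, F)\<in>trees_on U \<times> forests_on (S - U).
      q * nonroot_weight x y t * forest_weight x y q F)"
    using assms(1) by (subst sum.Sigma)
      (auto intro!: finite_cartesian_product finite_trees_on finite_forests_on intro: finite_subset)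
  also have "\<dots> = (\<Sum>U\<in>Pow S. q * tree_sum x y U * forest_sum x y q (S - U))"
    unfolding tree_sum_def forest_sum_def mult.assoc sum_product
    by (simp add: sum.cartesian_product[symmetric] sum_distrib_left mult.assoc)
  finally show ?thesis .
qed

section \<open>Sums over words\<close>

text \<open>The value 0 for \<open>i = j\<close> makes every permutation with a fixed point vanish,
  so the sums below can run over all permutations.\<close>

definition arc_weight :: "'r::comm_ring_1 \<Rightarrow> 'r \<Rightarrow> 'a::linorder \<Rightarrow> 'a \<Rightarrow> 'r" where
  "arc_weight x y i j = (if i < j then x else if j < i then y else 0)"

fun path_weight :: "'r::comm_ring_1 \<Rightarrow> 'r \<Rightarrow> 'a::linorder \<Rightarrow> 'a list \<Rightarrow> 'a \<Rightarrow> 'r" where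
  "path_weight x y a [] c = arc_weight x y a c"
| "path_weight x y a (b # w) c = arc_weight x y a b * path_weight x y b w c"

lemma path_weight_append:
  "path_weight x y a (u @ m # v) c = path_weight x y a u m * path_weight x y m v c"
  by (induction u arbitrary: a) (simp_all add: mult.assoc)

text \<open>Splitting at the minimum \<open>m\<close> produces words between \<open>a\<close> and
  \<open>m\<close> and words between \<open>m\<close> and \<open>c\<close>, hence the induction over
  arbitrary end points. As these lie below all letters, their values matter only for the empty
  word.\<close>

lemma sum_path_weight_eq_tree_sum:
  assumes "finite V" "\<And>v. v \<in> V \<Longrightarrow> a < v" "\<And>v. v \<in> V \<Longrightarrow> c < v"
  shows "(\<Sum>w\<in>permutations_of_set V. path_weight x y a w c) =
    tree_sum x y V + (if V = {} then arc_weight x y a c else 0)"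
  using assms
proof (induction V arbitrary: a c rule: finite_linorder_min_subset_induct)
  case empty
  then show ?case by simp
next
  case (insert m V)
  have am: "a < m" "c < m" using insert.prems by auto
  have V: "\<And>v. v \<in> V \<Longrightarrow> a < v" "\<And>v. v \<in> V \<Longrightarrow> c < v" using insert.prems by auto
  have nm: "m \<notin> V" using insert.hyps by blast
  let ?T = "tree_sum x y"
  have "(\<Sum>w\<in>permutations_of_set (insert m V). path_weight x y a w c) =
    (\<Sum>A\<in>Pow V. (\<Sum>u\<in>permutations_of_set A. path_weight x y a u m) *
       (\<Sum>v\<in>permutations_of_set (V - A). path_weight x y m v c))"
    by (simp add: sum_permutations_of_set_insert[OF insert.hyps(1) nm] path_weight_append sum_product)
  \<comment> \<open>An empty left part leaves the ascent from \<open>a\<close> to \<open>m\<close>,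
    an empty right part the descent from \<open>m\<close> to \<open>c\<close>.\<close>
  also have "\<dots> = (\<Sum>A\<in>Pow V. (?T A + (if A = {} then x else 0)) *
      (?T (V - A) + (if A = V then y else 0)))"
  proof (rule sum.cong[OF refl])
    fix A assume A: "A \<in> Pow V"
    then have VA: "V - A = {} \<longleftrightarrow> A = V" by auto
    have "(\<Sum>u\<in>permutations_of_set A. path_weight x y a u m) = ?T A + (if A = {} then x else 0)"
      using A am V insert.hyps by (subst insert.IH) (auto simp: arc_weight_def)
    moreover have "(\<Sum>v\<in>permutations_of_set (V - A). path_weight x y m v c) =
        ?T (V - A) + (if A = V then y else 0)"
      using A am V insert.hyps VA by (subst insert.IH) (auto simp: arc_weight_def)
    ultimately show "(\<Sum>u\<in>permutations_of_set A. path_weight x y a u m) *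
       (\<Sum>v\<in>permutations_of_set (V - A). path_weight x y m v c) =
       (?T A + (if A = {} then x else 0)) * (?T (V - A) + (if A = V then y else 0))"
      by simp
  qed
  \<comment> \<open>Either correction alone yields one half of the unary factor
    \<open>x + y\<close>. Both apply together only if \<open>A\<close> and \<open>V\<close> are
    empty, which is the leaf term \<open>x * y\<close>.\<close>
  also have "\<dots> = (\<Sum>A\<in>Pow V. ?T A * ?T (V - A) + (if A = {} then x * ?T V else 0) +
      (if A = V then ?T V * y else 0) + (if A = {} then if V = {} then x * y else 0 else 0))"
    by (intro sum.cong) (auto simp: algebra_simps)
  also have "\<dots> = (if V = {} then x * y else 0) + (x + y) * ?T V + (\<Sum>A\<in>Pow V. ?T A * ?T (V - A))"
    using insert.hyps(1) by (simp add: sum.distrib sum.delta algebra_simps)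
  also have "\<dots> = ?T (insert m V)"
    using insert.hyps by (simp add: tree_sum_insert)
  finally show ?case by simp
qed

section \<open>Sums over permutations\<close>

lemma self_in_orbit:
  assumes "finite A" "p permutes A"
  shows "a \<in> orbit p a"
  using assms permutation_self_in_orbit permutes_imp_permutation by metis

text \<open>Since \<open>p\<close> fixes \<open>b\<close>, the composite sends \<open>m\<close> to
  \<open>b\<close> and \<open>b\<close> to \<open>p m\<close>: it inserts \<open>b\<close> into the
  cycle of \<open>m\<close> right after \<open>m\<close> and changes no other arc.\<close>

lemma orbit_comp_transpose:
  assumes "finite A" "p permutes A - {b}" "m \<noteq> b" "i \<noteq> b"
  shows "orbit (p \<circ> transpose m b) i - {b} = orbit p i"
proof -
  let ?s = "p \<circ> transpose m b"
  have pb: "p b = b" using assms(2) by (simp add: permutes_not_in)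
  then have p_ne: "p z \<noteq> b" if "z \<noteq> b" for z
    using assms(2) that by (metis permutes_def)
  have s: "?s m = b" "?s b = p m" "\<And>z. z \<noteq> m \<Longrightarrow> z \<noteq> b \<Longrightarrow> ?s z = p z"
    using pb by (auto simp: transpose_def)
  have self: "z \<in> orbit p z" "z \<in> orbit ?s z" for z
  proof -
    show "z \<in> orbit p z" using assms self_in_orbit[of "A - {b}"] by simp
    have "?s permutes insert m (insert b A)"
      by (rule permutes_compose[OF permutes_swap_id permutes_subset[OF assms(2)]]) auto
    then show "z \<in> orbit ?s z" using assms self_in_orbit by (metis finite_insert)
  qed
  \<comment> \<open>A walk that stands at \<open>b\<close> came from \<open>m\<close>; recording
    that \<open>m\<close> lies in the orbit of \<open>p\<close> justifies the next move, to
    \<open>p m\<close>.\<close>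
  have "(z \<noteq> b \<longrightarrow> z \<in> orbit p i) \<and> (z = b \<longrightarrow> m \<in> orbit p i)" if "z \<in> orbit ?s i" for z
    using that
  proof induction
    case base
    then show ?case
      using s p_ne[of i] self assms(4) orbit.base[of p i] by (cases "i = m") auto
  next
    case (step z)
    then show ?case
      using s p_ne[of z] p_ne[of m] assms(3) orbit.step[of z p i] orbit.step[of m p i]
      by (cases "z = m"; cases "z = b") auto
  qed
  \<comment> \<open>Conversely, the arc of \<open>p\<close> leaving \<open>m\<close> is replaced by
    the two arcs through \<open>b\<close>.\<close>
  moreover have "z \<in> orbit ?s i \<and> z \<noteq> b" if "z \<in> orbit p i" for z
    using that
  proof induction
    case base
    then show ?case
      using s p_ne[of i] assms(4) orbit.base[of ?s i] orbit.step[of b ?s i]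
      by (cases "i = m") (simp_all del: comp_apply)
  next
    case (step z)
    then show ?case
      using s p_ne[of z] orbit.step[of z ?s i] orbit.step[of b ?s i]
      by (cases "z = m") (simp_all del: comp_apply)
  qed
  ultimately show ?thesis by blast
qed

text \<open>The point \<open>b\<close> joins an existing cycle, so deleting it matches the cycles of
  the composite with those of \<open>p\<close>.\<close>

lemma card_orbits_comp_transpose:
  assumes "finite A" "p permutes A - {b}" "m \<in> A" "b \<in> A" "m \<noteq> b"
  shows "card (orbit (p \<circ> transpose m b) ` A) = card (orbit p ` (A - {b}))"
proof -
  let ?s = "p \<circ> transpose m b"
  have s: "?s permutes A"
    by (rule permutes_compose[OF permutes_swap_id permutes_subset[OF assms(2)]]) (use assms in auto)
  note eq = orbit_comp_transpose[OF assms(1,2,5)]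
  have "?s m = b" using assms(2) by (simp add: permutes_not_in)
  then have "b \<in> orbit ?s m" by (metis orbit.base)
  then have "orbit ?s b = orbit ?s m"
    by (rule orbit_cyclic_eq3[OF cyclic_on_orbit[OF s assms(1)]])
  \<comment> \<open>Every cycle thus has a representative other than \<open>b\<close>, so the
    deletion of \<open>b\<close> cannot identify two cycles.\<close>
  then have A: "orbit ?s ` A = orbit ?s ` (A - {b})"
    using assms(3-5) by (metis (no_types, lifting) DiffI image_insert insert_Diff insert_absorb
        imageI singletonD)
  have "inj_on (\<lambda>X. X - {b}) (orbit ?s ` A)"
    unfolding A
  proof (rule inj_onI)
    fix X Y
    assume XY: "X \<in> orbit ?s ` (A - {b})" "Y \<in> orbit ?s ` (A - {b})" "X - {b} = Y - {b}"
    then obtain i j where ij: "i \<noteq> b" "X = orbit ?s i" "Y = orbit ?s j" by blast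
    then have "i \<in> orbit ?s j" using self_in_orbit[OF assms(1) s, of i] XY(3) by blast
    then show "X = Y"
      unfolding ij by (rule orbit_cyclic_eq3[OF cyclic_on_orbit[OF s assms(1)]])
  qed
  then have "card (orbit ?s ` A) = card ((\<lambda>X. X - {b}) ` orbit ?s ` A)"
    by (simp add: card_image)
  also have "(\<lambda>X. X - {b}) ` orbit ?s ` A = orbit p ` (A - {b})"
    unfolding A using eq by (force simp: image_image)
  finally show ?thesis .
qed

lemma card_orbits_fixed_point:
  assumes "finite S" "p permutes S" "m \<notin> S"
  shows "card (orbit p ` insert m S) = Suc (card (orbit p ` S))"
proof -
  have "p m = m" using assms by (simp add: permutes_not_in)
  have "m \<in> orbit p m" using assms self_in_orbit by metis
  have "orbit p i \<subseteq> S" if "i \<in> S" for i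
    using that assms by (simp add: permutes_orbit_subset)
  then have "orbit p m \<notin> orbit p ` S" using \<open>m \<in> orbit p m\<close> assms(3) by blast
  then show ?thesis using assms by simp
qed

section \<open>Permutations with the cycle through one point cut open\<close>

definition perm_sum :: "'r::comm_ring_1 \<Rightarrow> 'r \<Rightarrow> 'r \<Rightarrow> 'a::linorder set \<Rightarrow> 'r" where
  "perm_sum x y q S =
     (\<Sum>\<sigma> | \<sigma> permutes S. q ^ card (orbit \<sigma> ` S) * (\<Prod>i\<in>S. arc_weight x y i (\<sigma> i)))"

text \<open>Permutations of a larger set in which a path from \<open>m\<close> to \<open>a\<close> is contracted to
  the single point \<open>m\<close>: the arc leaving \<open>m\<close> is weighted as an arc leaving \<open>a\<close>.\<close>

definition open_sum :: "'r::comm_ring_1 \<Rightarrow> 'r \<Rightarrow> 'r \<Rightarrow> 'a::linorder set \<Rightarrow> 'a \<Rightarrow> 'a \<Rightarrow> 'r" where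
  "open_sum x y q S m a =
     (\<Sum>\<sigma> | \<sigma> permutes insert m S. q ^ card (orbit \<sigma> ` insert m S) *
        (arc_weight x y a (\<sigma> m) * (\<Prod>i\<in>S. arc_weight x y i (\<sigma> i))))"

lemma perm_sum_insert:
  "finite S \<Longrightarrow> m \<notin> S \<Longrightarrow> perm_sum x y q (insert m S) = open_sum x y q S m m"
  by (simp add: perm_sum_def open_sum_def)

text \<open>If \<open>b\<close> is the image of \<open>m\<close>, composing with
  \<open>transpose m b\<close> makes \<open>b\<close> a fixed point and leaves a permutation of
  \<open>A - {b}\<close>; the same involution leads back. For \<open>b = m\<close> it is the
  identity.\<close>

lemma sum_permutes_image_of_point:
  fixes g :: "('a \<Rightarrow> 'a) \<Rightarrow> 'b::comm_monoid_add"
  assumes "finite A" "m \<in> A"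
  shows "(\<Sum>\<sigma> | \<sigma> permutes A. g \<sigma>) =
    (\<Sum>b\<in>A. \<Sum>p | p permutes A - {b}. g (p \<circ> transpose m b))"
proof -
  have "(\<Sum>\<sigma> | \<sigma> permutes A. g \<sigma>) = (\<Sum>b\<in>A. \<Sum>\<sigma> | \<sigma> \<in> {\<sigma>. \<sigma> permutes A} \<and> \<sigma> m = b. g \<sigma>)"
    using assms by (subst sum.group) (auto simp: finite_permutations permutes_in_image)
  also have "\<dots> = (\<Sum>b\<in>A. \<Sum>p | p permutes A - {b}. g (p \<circ> transpose m b))"
  proof (rule sum.cong[OF refl])
    fix b assume "b \<in> A"
    show "(\<Sum>\<sigma> | \<sigma> \<in> {\<sigma>. \<sigma> permutes A} \<and> \<sigma> m = b. g \<sigma>) =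
        (\<Sum>p | p permutes A - {b}. g (p \<circ> transpose m b))"
    proof (rule sum.reindex_bij_witness[of _ "\<lambda>p. p \<circ> transpose m b" "\<lambda>p. p \<circ> transpose m b"])
      fix \<sigma> assume \<sigma>: "\<sigma> \<in> {\<sigma>. \<sigma> \<in> {\<sigma>. \<sigma> permutes A} \<and> \<sigma> m = b}"
      have "\<sigma> \<circ> transpose m b permutes A"
        using \<sigma> \<open>b \<in> A\<close> assms by (intro permutes_compose permutes_swap_id) auto
      moreover have "(\<sigma> \<circ> transpose m b) b = b" using \<sigma> by simp
      ultimately show "\<sigma> \<circ> transpose m b \<in> {p. p permutes A - {b}}"
        using permutes_superset by (metis (no_types, lifting) Diff_iff mem_Collect_eq singletonD)
    next
      fix p assume p: "p \<in> {p. p permutes A - {b}}"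
      then have "p \<circ> transpose m b permutes A"
        using \<open>b \<in> A\<close> assms
        by (intro permutes_compose[OF permutes_swap_id permutes_subset[of p "A - {b}"]]) auto
      moreover have "p b = b" using p by (simp add: permutes_not_in)
      ultimately show "p \<circ> transpose m b \<in> {\<sigma>. \<sigma> \<in> {\<sigma>. \<sigma> permutes A} \<and> \<sigma> m = b}" by simp
    qed (simp_all add: comp_assoc)
  qed
  finally show ?thesis .
qed

text \<open>Either the arc leaving \<open>m\<close> closes the cycle, or it leads to some \<open>b\<close>, which is
  absorbed into the contracted path.\<close>

lemma open_sum_rec:
  assumes "finite S" "m \<notin> S"
  shows "open_sum x y q S m a = q * arc_weight x y a m * perm_sum x y q S +
    (\<Sum>b\<in>S. arc_weight x y a b * open_sum x y q (S - {b}) m b)"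
proof -
  define g where "g \<sigma> = q ^ card (orbit \<sigma> ` insert m S) *
        (arc_weight x y a (\<sigma> m) * (\<Prod>i\<in>S. arc_weight x y i (\<sigma> i)))" for \<sigma>
  have "open_sum x y q S m a = (\<Sum>b\<in>insert m S. \<Sum>p | p permutes insert m S - {b}. g (p \<circ> transpose m b))"
    unfolding open_sum_def g_def[symmetric] using assms(1) by (intro sum_permutes_image_of_point) auto
  \<comment> \<open>The term \<open>b = m\<close>, where the transposition is trivial, is the case
    in which the cycle closes.\<close>
  also have "\<dots> = (\<Sum>p | p permutes S. g p) +
      (\<Sum>b\<in>S. \<Sum>p | p permutes insert m S - {b}. g (p \<circ> transpose m b))"
    using assms by simp
  also have "(\<Sum>p | p permutes S. g p) = q * arc_weight x y a m * perm_sum x y q S"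
    unfolding perm_sum_def sum_distrib_left
  proof (rule sum.cong[OF refl])
    fix p assume "p \<in> {p. p permutes S}"
    then have p: "p permutes S" by simp
    then have "p m = m" using assms by (simp add: permutes_not_in)
    then show "g p = q * arc_weight x y a m *
        (q ^ card (orbit p ` S) * (\<Prod>i\<in>S. arc_weight x y i (p i)))"
      unfolding g_def card_orbits_fixed_point[OF assms(1) p assms(2)] by (simp add: mult_ac)
  qed
  also have "(\<Sum>b\<in>S. \<Sum>p | p permutes insert m S - {b}. g (p \<circ> transpose m b)) =
      (\<Sum>b\<in>S. arc_weight x y a b * open_sum x y q (S - {b}) m b)"
  proof (rule sum.cong[OF refl])
    fix b assume b: "b \<in> S"
    then have mb: "m \<noteq> b" using assms by blast
    have ins: "insert m S - {b} = insert m (S - {b})" using mb by blast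
    have "g (p \<circ> transpose m b) = arc_weight x y a b *
       (q ^ card (orbit p ` insert m (S - {b})) *
         (arc_weight x y b (p m) * (\<Prod>i\<in>S - {b}. arc_weight x y i (p i))))"
      if "p permutes insert m (S - {b})" for p
    proof -
      have p: "p permutes insert m S - {b}" using that ins by simp
      have "p b = b" using p by (simp add: permutes_not_in)
      \<comment> \<open>The composite sends \<open>b\<close> to \<open>p m\<close>. In the
        contracted permutation this is the arc leaving \<open>m\<close>, now weighted as leaving
        \<open>b\<close> instead of \<open>a\<close>.\<close>
      moreover have "(\<Prod>i\<in>S. arc_weight x y i ((p \<circ> transpose m b) i)) =
          arc_weight x y b (p m) * (\<Prod>i\<in>S - {b}. arc_weight x y i (p i))"
      proof -
        have "(\<Prod>i\<in>S. arc_weight x y i ((p \<circ> transpose m b) i)) =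
            arc_weight x y b (p m) * (\<Prod>i\<in>S - {b}. arc_weight x y i ((p \<circ> transpose m b) i))"
          using assms(1) b by (subst prod.remove[of S b]) auto
        also have "(\<Prod>i\<in>S - {b}. arc_weight x y i ((p \<circ> transpose m b) i)) =
            (\<Prod>i\<in>S - {b}. arc_weight x y i (p i))"
          using assms(2) by (intro prod.cong) (auto simp: transpose_def)
        finally show ?thesis .
      qed
      moreover have "card (orbit (p \<circ> transpose m b) ` insert m S) =
          card (orbit p ` insert m (S - {b}))"
        using card_orbits_comp_transpose[OF _ p] assms b mb ins by simp
      ultimately show ?thesis by (simp add: g_def mult_ac)
    qed
    then show "(\<Sum>p | p permutes insert m S - {b}. g (p \<circ> transpose m b)) =
        arc_weight x y a b * open_sum x y q (S - {b}) m b"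
      by (simp add: ins open_sum_def sum_distrib_left)
  qed
  finally show ?thesis .
qed

section \<open>Reading the opened cycle as a word\<close>

definition words_in :: "'a set \<Rightarrow> 'a list set" where
  "words_in S = {w. distinct w \<and> set w \<subseteq> S}"

lemma words_in_rec: "words_in S = insert [] ((\<lambda>(b, w). b # w) ` (SIGMA b:S. words_in (S - {b})))"
proof (intro equalityI subsetI)
  fix w assume "w \<in> words_in S"
  then show "w \<in> insert [] ((\<lambda>(b, w). b # w) ` (SIGMA b:S. words_in (S - {b})))"
    by (cases w) (force simp: words_in_def)+
qed (auto simp: words_in_def)

lemma finite_words_in: "finite S \<Longrightarrow> finite (words_in S)"
  unfolding words_in_def using finite_subset_distinct[of S] by (simp add: conj_commute)

text \<open>Iterating \<open>open_sum_rec\<close> follows the cycle until it returns to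
  \<open>m\<close>: \<open>w\<close> lists the points passed, the closing arc brings the factor
  \<open>q\<close>, and the points not visited are permuted freely.\<close>

lemma open_sum_eq_sum_words:
  assumes "finite S" "m \<notin> S"
  shows "open_sum x y q S m a =
    (\<Sum>w\<in>words_in S. q * path_weight x y a w m * perm_sum x y q (S - set w))"
  using assms
proof (induction S arbitrary: a rule: finite_psubset_induct)
  case (psubset S)
  let ?f = "\<lambda>S a w. q * path_weight x y a w m * perm_sum x y q (S - set w)"
  have "(\<Sum>w\<in>words_in S. ?f S a w) =
      ?f S a [] + (\<Sum>(b, w)\<in>(SIGMA b:S. words_in (S - {b})). ?f S a (b # w))"
    using psubset.hyps
    by (subst words_in_rec, subst sum.insert)
      (auto simp: sum.reindex inj_on_def finite_words_in case_prod_unfold)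
  also have "\<dots> = ?f S a [] + (\<Sum>b\<in>S. \<Sum>w\<in>words_in (S - {b}). ?f S a (b # w))"
    using psubset.hyps by (simp add: sum.Sigma finite_words_in)
  also have "(\<Sum>b\<in>S. \<Sum>w\<in>words_in (S - {b}). ?f S a (b # w)) =
      (\<Sum>b\<in>S. arc_weight x y a b * open_sum x y q (S - {b}) m b)"
  proof (rule sum.cong[OF refl])
    fix b assume "b \<in> S"
    then have "open_sum x y q (S - {b}) m b = (\<Sum>w\<in>words_in (S - {b}). ?f (S - {b}) b w)"
      using psubset.prems by (intro psubset.IH) auto
    moreover have "S - {b} - set w = S - set (b # w)" for w by auto
    ultimately show "(\<Sum>w\<in>words_in (S - {b}). ?f S a (b # w)) =
        arc_weight x y a b * open_sum x y q (S - {b}) m b"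
      by (simp add: sum_distrib_left mult_ac)
  qed
  finally show ?case
    using open_sum_rec[OF psubset.hyps psubset.prems, of x y q a] by simp
qed

text \<open>Grouping the words by their letter set \<open>U\<close> leaves all arrangements of
  \<open>U\<close> between two copies of the minimum \<open>m\<close>, and these sum to the tree
  sum. The result has the shape of \<open>forest_sum_insert\<close>.\<close>

lemma perm_sum_insert_min:
  assumes "finite S" "\<And>v. v \<in> S \<Longrightarrow> m < v"
  shows "perm_sum x y q (insert m S) =
    (\<Sum>U\<in>Pow S. q * tree_sum x y U * perm_sum x y q (S - U))"
proof -
  have m: "m \<notin> S" using assms by blast
  have "perm_sum x y q (insert m S) =
      (\<Sum>w\<in>words_in S. q * path_weight x y m w m * perm_sum x y q (S - set w))"
    using assms(1) m by (simp add: perm_sum_insert open_sum_eq_sum_words)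
  also have "\<dots> = (\<Sum>U\<in>Pow S. \<Sum>w | w \<in> words_in S \<and> set w = U.
      q * path_weight x y m w m * perm_sum x y q (S - set w))"
    using assms(1) by (subst sum.group) (auto simp: finite_words_in, auto simp: words_in_def)
  also have "\<dots> = (\<Sum>U\<in>Pow S. q * tree_sum x y U * perm_sum x y q (S - U))"
  proof (rule sum.cong[OF refl])
    fix U assume U: "U \<in> Pow S"
    then have eq: "{w. w \<in> words_in S \<and> set w = U} = permutations_of_set U"
      by (auto simp: words_in_def permutations_of_set_def)
    have "(\<Sum>w | w \<in> words_in S \<and> set w = U.
        q * path_weight x y m w m * perm_sum x y q (S - set w)) =
        (\<Sum>w\<in>permutations_of_set U. q * path_weight x y m w m * perm_sum x y q (S - U))"
      unfolding eq by (rule sum.cong) (auto simp: permutations_of_set_def)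
    also have "\<dots> = q * (\<Sum>w\<in>permutations_of_set U. path_weight x y m w m) * perm_sum x y q (S - U)"
      by (simp add: sum_distrib_left sum_distrib_right)
    \<comment> \<open>For \<open>U = {}\<close> the arc from \<open>m\<close> to itself has weight
      0: a fixed point counts for nothing, just as a single root is no planted tree.\<close>
    also have "(\<Sum>w\<in>permutations_of_set U. path_weight x y m w m) = tree_sum x y U"
      using U assms by (subst sum_path_weight_eq_tree_sum) (auto simp: arc_weight_def finite_subset)
    finally show "(\<Sum>w | w \<in> words_in S \<and> set w = U.
        q * path_weight x y m w m * perm_sum x y q (S - set w)) =
        q * tree_sum x y U * perm_sum x y q (S - U)" .
  qed
  finally show ?thesis .
qed

section \<open>Comparison of the two recursions and return to derangements\<close>

lemma perm_sum_eq_forest_sum: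
  assumes "finite S"
  shows "perm_sum x y q S = forest_sum x y q S"
  using assms
  \<comment> \<open>Both sums equal 1 on the empty set and obey the same recursion in the
    minimum.\<close>
  by (induction S rule: finite_linorder_min_subset_induct)
    (simp_all add: perm_sum_def[of _ _ _ "{}"] perm_sum_insert_min forest_sum_insert)

text \<open>Permutations with a fixed point add 0. In a derangement every arc is an excedance or a
  drop, so the product of the arc weights collects the powers of \<open>x\<close> and
  \<open>y\<close>.\<close>

lemma derangement_poly_eq_perm_sum: "derangement_poly n x y q = perm_sum x y q {1..n}"
  unfolding derangement_poly_def perm_sum_def
proof (rule sum.mono_neutral_cong_left)
  show "finite {\<sigma>. \<sigma> permutes {1..n}}" by (simp add: finite_permutations)
  show "derangements n \<subseteq> {\<sigma>. \<sigma> permutes {1..n}}" by (auto simp: derangements_def)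
  show "\<forall>\<sigma>\<in>{\<sigma>. \<sigma> permutes {1..n}} - derangements n.
      q ^ card (orbit \<sigma> ` {1..n}) * (\<Prod>i\<in>{1..n}. arc_weight x y i (\<sigma> i)) = 0"
  proof
    fix \<sigma> assume "\<sigma> \<in> {\<sigma>. \<sigma> permutes {1..n}} - derangements n"
    then obtain i where "i \<in> {1..n}" "\<sigma> i = i" by (auto simp: derangements_def)
    then have "\<exists>i\<in>{1..n}. arc_weight x y i (\<sigma> i) = 0"
      by (intro bexI[of _ i]) (simp_all add: arc_weight_def)
    then have "(\<Prod>i\<in>{1..n}. arc_weight x y i (\<sigma> i)) = 0"
      by (intro prod_zero) auto
    then show "q ^ card (orbit \<sigma> ` {1..n}) * (\<Prod>i\<in>{1..n}. arc_weight x y i (\<sigma> i)) = 0"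
      by simp
  qed
next
  fix \<sigma> assume \<sigma>: "\<sigma> \<in> derangements n"
  have "\<sigma> i \<noteq> i" if "i \<in> {1..n}" for i using that \<sigma>
    unfolding derangements_def by blast
  then have "(\<Prod>i\<in>{1..n}. arc_weight x y i (\<sigma> i)) =
      (\<Prod>i\<in>{1..n}. (if \<sigma> i > i then x else 1) * (if \<sigma> i < i then y else 1))"
    by (intro prod.cong) (auto simp: arc_weight_def neq_iff)
  also have "\<dots> = x ^ exc n \<sigma> * y ^ drops n \<sigma>"
    by (simp add: prod.distrib exc_def drops_def prod.inter_filter[symmetric])
  finally show "x ^ exc n \<sigma> * y ^ drops n \<sigma> * q ^ cyc n \<sigma> =
      q ^ card (orbit \<sigma> ` {1..n}) * (\<Prod>i\<in>{1..n}. arc_weight x y i (\<sigma> i))"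
    by (simp add: cyc_def mult_ac)
qed

theorem theorem2p6:
  fixes n :: nat and x y q :: "'r::comm_ring_1"
  assumes "n \<ge> 1"
  shows "derangement_poly n x y q =
    (\<Sum>F | planted_forest_on {1..n} F. forest_weight x y q F)"
  using perm_sum_eq_forest_sum[of "{1..n}" x y q]
  by (simp add: derangement_poly_eq_perm_sum forest_sum_def forests_on_def)

end
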